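(* Let $A$ be a coherent quantale. Then the topological space $Max_F(A)$ is Hausdorff and zero-dimensional.
   Context: A quantale here means a complete lattice $A$ with bottom $0$ and top $1$, with an associative commutative multiplication that distributes over arbitrary joins and has $1$ as unit. $K(A)$ is the set of compact elements. $A$ is coherent if every element is a join of compact elements, $1\in K(A)$, and $K(A)$ is closed under multiplication. An element $p<1$ is $m$-prime if for all $a,b\in A$, $ab\leq p$ implies $a\leq p$ or $b\leq p$; $Spec(A)$ is the set of $m$-prime elements. $Max(A)$ is the set of maximal elements of $A\setminus\{1\}$; for coherent $A$, $Max(A)\subseteq Spec(A)$. For $a\in A$, $V(a)=\{p\in Spec(A): a\leq p\}$. The flat topology on $Spec(A)$ has $\{V(c): c\in K(A)\}$ as a basis of open sets; $Max_F(A)$ is $Max(A)$ with the subspace topology of the flat topology. Zero-dimensional means having a basis of clopen sets. *)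

theory Defs
  imports "HOL-Analysis.Analysis"
begin

definition (in complete_lattice) compact_element :: "'a \<Rightarrow> bool" where
  "compact_element c \<longleftrightarrow> (\<forall>S. c \<le> Sup S \<longrightarrow> (\<exists>T. finite T \<and> T \<subseteq> S \<and> c \<le> Sup T))"

definition (in complete_lattice) compact_elements :: "'a set" where
  "compact_elements = {c. compact_element c}"

text \<open>The empty join is included in the distributive law, so \<^term>\<open>bot\<close> is absorbing.\<close>

class quantale = complete_lattice + comm_monoid_mult +
  assumes mult_Sup: "a * Sup S = Sup ((\<lambda>s. a * s) ` S)"
    and one_eq_top: "1 = top"

class coherent_quantale = quantale +
  assumes join_of_compacts: "\<exists>S. S \<subseteq> compact_elements \<and> a = Sup S"
    and compact_one: "1 \<in> compact_elements"
    and compact_mult: "c \<in> compact_elements \<Longrightarrow> d \<in> compact_elements \<Longrightarrow> c * d \<in> compact_elements"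

definition Spec :: "'a::quantale set" where
  "Spec = {p. p < 1 \<and> (\<forall>a b. a * b \<le> p \<longrightarrow> a \<le> p \<or> b \<le> p)}"

definition Max_Spec :: "'a::quantale set" where
  "Max_Spec = {m. m \<noteq> 1 \<and> (\<forall>x. x \<noteq> 1 \<longrightarrow> m \<le> x \<longrightarrow> x = m)}"

definition V :: "'a::quantale \<Rightarrow> 'a set" where
  "V a = {p \<in> Spec. a \<le> p}"

definition flat_topology :: "'a::quantale topology" where
  "flat_topology = topology (arbitrary union_of (\<lambda>U. U \<in> V ` compact_elements))"

definition Max_F :: "'a::quantale topology" where
  "Max_F = subtopology flat_topology Max_Spec"

definition zero_dimensional_space :: "'a topology \<Rightarrow> bool" where
  "zero_dimensional_space X \<longleftrightarrow>
     (\<exists>\<B>. (\<forall>U\<in>\<B>. openin X U \<and> closedin X U) \<and> openin X = arbitrary union_of (\<lambda>U. U \<in> \<B>))"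

text \<open>
  The lemmas below justify the definitions: the sets \<open>V c\<close> for compact \<open>c\<close> really are a basis of
  \<^const>\<open>flat_topology\<close>, and the points of \<^const>\<open>Max_F\<close> are exactly the maximal elements.
\<close>

lemma compact_element_bot: "compact_element (bot :: 'a::complete_lattice)"
  unfolding compact_element_def by (metis bot_least empty_subsetI finite.emptyI)

lemma compact_element_sup:
  assumes "compact_element c" "compact_element d"
  shows "compact_element (sup c d :: 'a::complete_lattice)"
  unfolding compact_element_def
proof (intro allI impI)
  fix S :: "'a set"
  assume "sup c d \<le> Sup S"
  then obtain T T' where "finite T" "T \<subseteq> S" "c \<le> Sup T" "finite T'" "T' \<subseteq> S" "d \<le> Sup T'"
    using assms unfolding compact_element_def by (meson le_sup_iff)
  then show "\<exists>T. finite T \<and> T \<subseteq> S \<and> sup c d \<le> Sup T"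
    by (intro exI[of _ "T \<union> T'"]) (auto simp: Sup_union_distrib intro: le_supI1 le_supI2)
qed

lemma openin_flat_topology:
  "openin (flat_topology :: 'a::quantale topology) = arbitrary union_of (\<lambda>U. U \<in> V ` compact_elements)"
proof -
  have "V c \<inter> V d = V (sup c d)" for c d :: 'a
    by (auto simp: V_def)
  then have "istopology (arbitrary union_of (\<lambda>U. U \<in> V ` (compact_elements :: 'a set)))"
    by (intro istopology_base) (auto simp: compact_elements_def compact_element_sup)
  then show ?thesis
    unfolding flat_topology_def by (rule topology_inverse')
qed

lemma topspace_flat_topology: "topspace (flat_topology :: 'a::quantale topology) = Spec"
proof
  show "topspace (flat_topology :: 'a topology) \<subseteq> Spec"
    using openin_topspace[of "flat_topology :: 'a topology"]
    by (auto simp: openin_flat_topology union_of_def V_def)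
  have "openin flat_topology (V (bot :: 'a))"
    unfolding openin_flat_topology
    by (rule arbitrary_union_of_inc) (auto simp: compact_elements_def compact_element_bot)
  then show "Spec \<subseteq> topspace (flat_topology :: 'a topology)"
    using openin_subset by (fastforce simp: V_def)
qed

lemma mult_sup_right: "(a::'a::quantale) * sup b c = sup (a * b) (a * c)"
  using mult_Sup[of a "{b, c}"] by simp

lemma mult_le_right: "(a::'a::quantale) * b \<le> b"
proof -
  have "sup (b * a) b = b"
    using mult_sup_right[of b a 1] by (simp add: one_eq_top)
       (metis mult.right_neutral one_eq_top)
  then show ?thesis
    by (metis mult.commute sup.cobounded1)
qed

lemma Max_Spec_subset_Spec: "(Max_Spec :: 'a::quantale set) \<subseteq> Spec"
proof
  fix m :: 'a
  assume m: "m \<in> Max_Spec"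
  have top: "sup x m = 1" if "\<not> x \<le> m" for x
    using m that unfolding Max_Spec_def by (metis (mono_tags, lifting) mem_Collect_eq sup.cobounded1 sup.cobounded2)
  have "a \<le> m \<or> b \<le> m" if ab: "a * b \<le> m" for a b
  proof (rule ccontr)
    assume "\<not> (a \<le> m \<or> b \<le> m)"
    then have "sup a m = 1" "sup b m = 1"
      by (auto intro: top)
    then have "1 = sup a m * sup b m"
      by simp
    also have "\<dots> = sup (sup a m * b) (sup a m * m)"
      by (rule mult_sup_right)
    also have "sup a m * b = sup (b * a) (b * m)"
      by (metis mult.commute mult_sup_right)
    also have "sup (sup (b * a) (b * m)) (sup a m * m) \<le> m"
      using ab by (simp add: mult_le_right mult.commute[of b a])
    finally have "m = 1"
      by (simp add: one_eq_top top_unique)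
    then show False
      using m by (simp add: Max_Spec_def)
  qed
  moreover have "m < 1"
    using m by (auto simp: Max_Spec_def one_eq_top top.not_eq_extremum)
  ultimately show "m \<in> Spec"
    by (auto simp: Spec_def)
qed

lemma topspace_Max_F: "topspace (Max_F :: 'a::quantale topology) = Max_Spec"
  using Max_Spec_subset_Spec by (auto simp: Max_F_def topspace_flat_topology)

end

theory Submission
  imports Defs
begin

text \<open>For compact \<open>c\<close> and a maximal element \<open>m\<close> not above \<open>c\<close>, the join of \<open>c\<close> and \<open>m\<close> is \<open>1\<close>; by
  compactness of \<open>1\<close> there is a compact \<open>d \<le> m\<close> whose join with \<open>c\<close> is already \<open>1\<close>, so \<open>V d\<close> is a
  neighbourhood of \<open>m\<close> disjoint from \<open>V c\<close>. Hence the basic open sets of \<^const>\<open>Max_F\<close> are clopen, and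
  they separate points because every element is a join of compact elements.\<close>

lemma compact_element_Sup:
  fixes T :: "'a::complete_lattice set"
  assumes "finite T" "\<And>x. x \<in> T \<Longrightarrow> compact_element x"
  shows "compact_element (Sup T)"
  using assms by (induction T) (auto simp: compact_element_bot compact_element_sup)

lemma Max_Spec_sup_eq_one:
  assumes "m \<in> Max_Spec" "\<not> x \<le> m"
  shows "sup x m = (1 :: 'a::quantale)"
proof (rule ccontr)
  assume "sup x m \<noteq> 1"
  then have "sup x m = m"
    using assms(1) by (simp add: Max_Spec_def)
  then show False
    using assms(2) by (metis sup.cobounded1)
qed

lemma Max_Spec_compact_complement:
  fixes m :: "'a::coherent_quantale"
  assumes "m \<in> Max_Spec" "\<not> c \<le> m"
  obtains d where "d \<in> compact_elements" "d \<le> m" "sup c d = 1"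
proof -
  obtain S where S: "S \<subseteq> compact_elements" "m = Sup S"
    using join_of_compacts by blast
  have "1 \<le> Sup (insert c S)"
    using Max_Spec_sup_eq_one[OF assms] S by simp
  then obtain T where T: "finite T" "T \<subseteq> insert c S" "1 \<le> Sup T"
    using compact_one unfolding compact_elements_def compact_element_def by blast
  show thesis
  proof
    show "Sup (T - {c}) \<in> compact_elements"
      using S(1) T by (auto simp: compact_elements_def intro!: compact_element_Sup)
    show "Sup (T - {c}) \<le> m"
      using S(2) T(2) by (auto intro!: Sup_subset_mono)
    have "Sup T \<le> sup c (Sup (T - {c}))"
    proof (rule Sup_least)
      fix x
      assume "x \<in> T"
      then show "x \<le> sup c (Sup (T - {c}))"
        by (cases "x = c") (simp_all add: Sup_upper le_supI2)
    qed
    then show "sup c (Sup (T - {c})) = 1"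
      using T(3) by (simp add: one_eq_top top_unique)
  qed
qed

lemma Max_Spec_compact_below:
  fixes m :: "'a::coherent_quantale"
  assumes "m \<in> Max_Spec" "n \<in> Max_Spec" "m \<noteq> n"
  obtains c where "c \<in> compact_elements" "c \<le> m" "\<not> c \<le> n"
proof -
  obtain S where S: "S \<subseteq> compact_elements" "m = Sup S"
    using join_of_compacts by blast
  have "\<not> Sup S \<le> n"
    using assms S(2) by (auto simp: Max_Spec_def)
  then obtain c where "c \<in> S" "\<not> c \<le> n"
    by (auto simp: Sup_le_iff)
  with S that show thesis
    by (auto intro: Sup_upper)
qed

lemma openin_Max_F:
  "openin (Max_F :: 'a::quantale topology) =
    arbitrary union_of (\<lambda>U. U \<in> (\<lambda>c. Max_Spec \<inter> V c) ` compact_elements)"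
proof -
  have "((\<lambda>U. U \<in> V ` (compact_elements :: 'a set)) relative_to Max_Spec) =
      (\<lambda>U. U \<in> (\<lambda>c. Max_Spec \<inter> V c) ` compact_elements)"
    by (auto simp: relative_to_def fun_eq_iff)
  then show ?thesis
    by (simp add: Max_F_def openin_subtopology_alt openin_flat_topology
        openin_relative_to [symmetric] arbitrary_union_of_relative_to)
qed

lemma openin_Max_F_V:
  "c \<in> compact_elements \<Longrightarrow> openin (Max_F :: 'a::quantale topology) (Max_Spec \<inter> V c)"
  unfolding openin_Max_F by (rule arbitrary_union_of_inc) blast

lemma closedin_Max_F_V:
  fixes c :: "'a::coherent_quantale"
  shows "closedin Max_F (Max_Spec \<inter> V c)"
  unfolding closedin_def
proof
  show "Max_Spec \<inter> V c \<subseteq> topspace Max_F"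
    by (simp add: topspace_Max_F)
  show "openin Max_F (topspace Max_F - Max_Spec \<inter> V c)"
  proof (subst openin_subopen, intro ballI)
    fix m
    assume "m \<in> topspace Max_F - Max_Spec \<inter> V c"
    then have m: "m \<in> Max_Spec" "m \<in> Spec" "\<not> c \<le> m"
      using Max_Spec_subset_Spec by (auto simp: topspace_Max_F V_def)
    then obtain d where d: "d \<in> compact_elements" "d \<le> m" "sup c d = 1"
      using Max_Spec_compact_complement by blast
    have "\<not> c \<le> n" if "n \<in> Max_Spec" "d \<le> n" for n
      using that d(3) by (metis (mono_tags, lifting) Max_Spec_def le_sup_iff mem_Collect_eq one_eq_top top_unique)
    then have "Max_Spec \<inter> V d \<subseteq> topspace Max_F - Max_Spec \<inter> V c"
      by (auto simp: topspace_Max_F V_def)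
    moreover have "m \<in> Max_Spec \<inter> V d"
      using m d by (simp add: V_def)
    ultimately show "\<exists>U. openin Max_F U \<and> m \<in> U \<and> U \<subseteq> topspace Max_F - Max_Spec \<inter> V c"
      using openin_Max_F_V[OF d(1)] by blast
  qed
qed

theorem proposition7p2:
  shows "Hausdorff_space (Max_F :: 'a::coherent_quantale topology) \<and>
    zero_dimensional_space (Max_F :: 'a::coherent_quantale topology)"
proof
  show "Hausdorff_space (Max_F :: 'a topology)"
    unfolding Hausdorff_space_def topspace_Max_F
  proof (intro allI impI)
    fix m n :: 'a
    assume mn: "m \<in> Max_Spec \<and> n \<in> Max_Spec \<and> m \<noteq> n"
    then obtain c where c: "c \<in> compact_elements" "c \<le> m" "\<not> c \<le> n"
      using Max_Spec_compact_below by blast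
    have "openin Max_F (topspace Max_F - Max_Spec \<inter> V c)"
      using closedin_Max_F_V[of c] by (simp add: closedin_def)
    moreover have "m \<in> Max_Spec \<inter> V c" "n \<in> topspace Max_F - Max_Spec \<inter> V c"
      using mn c Max_Spec_subset_Spec by (auto simp: V_def topspace_Max_F)
    ultimately show "\<exists>U W. openin Max_F U \<and> openin Max_F W \<and> m \<in> U \<and> n \<in> W \<and> disjnt U W"
      using openin_Max_F_V[OF c(1)]
      by (intro exI[of _ "Max_Spec \<inter> V c"] exI[of _ "topspace Max_F - Max_Spec \<inter> V c"])
        (simp add: disjnt_def)
  qed
  show "zero_dimensional_space (Max_F :: 'a topology)"
    unfolding zero_dimensional_space_def
  proof (intro exI conjI)
    show "\<forall>U \<in> (\<lambda>c. Max_Spec \<inter> V c) ` compact_elements.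
        openin (Max_F :: 'a topology) U \<and> closedin Max_F U"
      by (simp add: openin_Max_F_V closedin_Max_F_V)
  qed (rule openin_Max_F)
qed

end
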